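(* Let $m\ge 2$. Consider either (i) $\xi=\operatorname{diam}$ and $\zeta$ the covering radius $\zeta(\Lambda)=\inf\{t>0:\Lambda+t\mathbf{B}=\mathbb{R}^m\}$, in the undirected case ($\mathcal{G}=C_{\mathbb{Z}^m/\Lambda}(I)$) or the directed case ($\mathcal{G}=C^+_{\mathbb{Z}^m/\Lambda}(I)$) with the corresponding $\mathbf{B}$; or (ii) the directed case, $\xi=\operatorname{girth}$ and $\zeta(\Lambda)=\inf\{t>0:t\mathbf{B}\cap\Lambda\neq\{0\}\}$. Then there is a constant $C$ such that for every finite index subgroup $\Lambda<\mathbb{Z}^m$, $|\xi(\mathcal{G})-\zeta(\Lambda)|\le C$ and $\big||\Lambda|^{-1/m}\xi(\mathcal{G})-\zeta(\bar\Lambda)\big|\le C|\Lambda|^{-1/m}$.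
   Context: $I$ is the standard basis of $\mathbb{Z}^m$; $C_{\mathbb{Z}^m/\Lambda}(I)$ is the Cayley graph of $\mathbb{Z}^m/\Lambda$ with respect to the images of the standard basis vectors ($x$ adjacent to $x+e_j$), and $C^+_{\mathbb{Z}^m/\Lambda}(I)$ the Cayley digraph (edges $x\to x+e_j$), with directed path distance. The diameter is the maximum distance between vertices (ordered pairs in the directed case); the girth of a digraph is the length of a shortest directed cycle. $|\Lambda|$ is the covolume (index) of $\Lambda$ and $\bar\Lambda=|\Lambda|^{-1/m}\Lambda$. $\mathbf{B}=\{v\in\mathbb{R}^m:\sum|v_i|<1\}$ in the undirected case and $\mathbf{B}=\{v\in\mathbb{R}^m:v_i\ge0\ \forall i,\ \sum v_i<1\}$ in the directed case. *)

theory Defs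
  imports "HOL-Analysis.Analysis"
begin

text \<open>Subgroups of Z^m (Z^m rendered as int ^ 'n, m = CARD('n)).\<close>

definition is_subgroup :: "(int ^ 'n) set \<Rightarrow> bool" where
  "is_subgroup L \<longleftrightarrow> 0 \<in> L \<and> (\<forall>x\<in>L. \<forall>y\<in>L. x + y \<in> L) \<and> (\<forall>x\<in>L. - x \<in> L)"

text \<open>The quotient group Z^m / L as a set of cosets.\<close>
definition cosets :: "(int ^ 'n) set \<Rightarrow> (int ^ 'n) set set" where
  "cosets L = UNIV // {(x, y). x - y \<in> L}"

definition finite_index :: "(int ^ 'n) set \<Rightarrow> bool" where
  "finite_index L \<longleftrightarrow> finite (cosets L)"

text \<open>Covolume = index |L|.\<close>
definition covol :: "(int ^ 'n) set \<Rightarrow> nat" where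
  "covol L = card (cosets L)"

text \<open>Undirected Cayley graph: a step is \<open>x \<mapsto> x \<plusminus> e_j\<close>; a walk is a list of steps.\<close>
definition ustep :: "'n \<times> bool \<Rightarrow> int ^ 'n" where
  "ustep s = (if snd s then axis (fst s) 1 else - axis (fst s) 1)"

text \<open>Graph distance in \<open>C_{Z^m/L}(I)\<close> between the vertices x + L and y + L.\<close>
definition udist :: "(int ^ 'n) set \<Rightarrow> int ^ 'n \<Rightarrow> int ^ 'n \<Rightarrow> nat" where
  "udist L x y = (LEAST k. \<exists>ss. length ss = k \<and> x + sum_list (map ustep ss) - y \<in> L)"

definition udiam :: "(int ^ 'n) set \<Rightarrow> nat" where
  "udiam L = Max {udist L x y | x y. True}"

text \<open>Directed Cayley graph: edges \<open>x \<rightarrow> x + e_j\<close>.\<close>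
definition dstep :: "'n \<Rightarrow> int ^ 'n" where
  "dstep j = axis j 1"

definition ddist :: "(int ^ 'n) set \<Rightarrow> int ^ 'n \<Rightarrow> int ^ 'n \<Rightarrow> nat" where
  "ddist L x y = (LEAST k. \<exists>js. length js = k \<and> x + sum_list (map dstep js) - y \<in> L)"

definition ddiam :: "(int ^ 'n) set \<Rightarrow> nat" where
  "ddiam L = Max {ddist L x y | x y. True}"

text \<open>Girth of the directed Cayley graph: length of a shortest directed cycle,
  i.e. a closed walk of length k \<ge> 1 visiting k distinct vertices
  (cosets of the partial sums).\<close>
definition dgirth :: "(int ^ 'n) set \<Rightarrow> nat" where
  "dgirth L = (LEAST k. k \<ge> 1 \<and> (\<exists>js. length js = k \<and>
      sum_list (map dstep js) \<in> L \<and>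
      (\<forall>i<k. \<forall>i'<k. i \<noteq> i' \<longrightarrow>
          sum_list (map dstep (take i js)) - sum_list (map dstep (take i' js)) \<notin> L)))"

text \<open>Embedding Z^m into R^m.\<close>
definition emb :: "int ^ 'n \<Rightarrow> real ^ 'n" where
  "emb v = (\<chi> i. real_of_int (v $ i))"

text \<open>The bodies B.\<close>
definition Bu :: "(real ^ 'n) set" where
  "Bu = {v. (\<Sum>i\<in>UNIV. \<bar>v $ i\<bar>) < 1}"

definition Bd :: "(real ^ 'n) set" where
  "Bd = {v. (\<forall>i. 0 \<le> v $ i) \<and> (\<Sum>i\<in>UNIV. v $ i) < 1}"

text \<open>Covering radius of a set R of points in R^m w.r.t. body B.\<close>
definition cov_radius :: "(real ^ 'n) set \<Rightarrow> (real ^ 'n) set \<Rightarrow> real" where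
  "cov_radius B R = Inf {t. t > 0 \<and> {l + t *\<^sub>R b | l b. l \<in> R \<and> b \<in> B} = UNIV}"

text \<open>First minimum: inf {t > 0 : tB \<inter> R \<noteq> {0}}.\<close>
definition min_radius :: "(real ^ 'n) set \<Rightarrow> (real ^ 'n) set \<Rightarrow> real" where
  "min_radius B R = Inf {t. t > 0 \<and> ((\<lambda>b. t *\<^sub>R b) ` B) \<inter> R \<noteq> {0}}"

text \<open>The real lattice L and its normalisation \<open>L-bar = |L|^(-1/m) L\<close>.\<close>
definition rlat :: "(int ^ 'n) set \<Rightarrow> (real ^ 'n) set" where
  "rlat L = emb ` L"

definition nlat :: "(int ^ 'n) set \<Rightarrow> (real ^ 'n) set" where
  "nlat L = (\<lambda>v. (real (covol L) powr (- 1 / real CARD('n))) *\<^sub>R v) ` rlat L"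

end

theory Submission
  imports Defs
begin

text \<open>
  The distance from x to y + L in either Cayley graph is the least l1-norm of an integer
  displacement v with x + v \<equiv> y (mod L), where in the directed case v must lie in the
  nonnegative orthant; both cases are handled at once by restricting v to a convex cone C
  containing the orthant. Split a point p of R^m into an integer point and a fractional part
  in [0,1)^m: moving the integer point to the lattice along a shortest displacement shows that
  L + (D + m) B covers R^m, D being the diameter. Conversely, if L + t B covers R^m, every
  coset is reached by a displacement of norm less than t, so D < t. Thus the covering radius
  lies in [D, D + m]. For the girth, a shortest closed walk is already a cycle, and closed
  walks correspond to nonzero nonnegative lattice vectors, so the girth equals the first
  minimum of L with respect to the simplex body exactly. Both radii are homogeneous under
  scaling, which gives the normalised bounds.
\<close>

section \<open>Subgroups of finite index\<close>

lemma subgroup_diff_swap: "is_subgroup L \<Longrightarrow> x - y \<in> L \<Longrightarrow> y - x \<in> L"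
  unfolding is_subgroup_def by (metis minus_diff_eq)

lemma subgroup_sum: "is_subgroup L \<Longrightarrow> (\<And>i. i \<in> A \<Longrightarrow> f i \<in> L) \<Longrightarrow> sum f A \<in> L"
  by (induction A rule: infinite_finite_induct) (auto simp: is_subgroup_def)

lemma subgroup_smult_mem:
  assumes "is_subgroup L" "v \<in> L"
  shows "q *s v \<in> L"
proof -
  have nat_mult: "int k *s v \<in> L" for k
    by (induction k) (use assms in \<open>auto simp: is_subgroup_def vector_sadd_rdistrib\<close>)
  show ?thesis
  proof (cases "q \<ge> 0")
    case True
    then show ?thesis using nat_mult[of "nat q"] by simp
  next
    case False
    have "q *s v = - (int (nat (- q)) *s v)" using False by (simp add: vec_eq_iff)
    moreover have "- (int (nat (- q)) *s v) \<in> L" using nat_mult assms(1) by (simp only: is_subgroup_def)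
    ultimately show ?thesis by simp
  qed
qed


lemma finite_index_multiple_mem:
  assumes "is_subgroup L" "finite_index L"
  shows "\<exists>d > 0. d *s u \<in> L"
proof -
  let ?class = "\<lambda>k::nat. {(x, y). x - y \<in> L} `` {int k *s u}"
  let ?n = "card (cosets L)"
  have "?class ` {0..?n} \<subseteq> cosets L"
    unfolding cosets_def by (intro image_subsetI quotientI) simp
  then have "card (?class ` {0..?n}) \<le> ?n"
    using assms(2) card_mono unfolding finite_index_def by blast
  then have "card (?class ` {0..?n}) < card {0..?n}" by simp
  then obtain a' b' where "a' \<noteq> b'" "?class a' = ?class b'"
    using pigeonhole unfolding inj_on_def by blast
  then obtain a b where ab: "a < b" "?class a = ?class b"
    by (metis nat_neq_iff)
  have "int b *s u \<in> ?class a"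
    using ab(2) assms(1) by (simp add: is_subgroup_def)
  then have "- (int a *s u - int b *s u) \<in> L"
    using assms(1) unfolding is_subgroup_def by blast
  moreover have "- (int a *s u - int b *s u) = (int b - int a) *s u"
    by (simp add: vec_eq_iff algebra_simps)
  ultimately show ?thesis using ab(1) by (intro exI[of _ "int b - int a"]) auto
qed

lemma finite_index_contains_multiples:
  assumes "is_subgroup L" "finite_index (L :: (int ^ 'n) set)"
  shows "\<exists>N > 0. \<forall>v. (\<forall>i. N dvd v $ i) \<longrightarrow> v \<in> L"
proof -
  have "\<forall>j. \<exists>d > 0. d *s axis j 1 \<in> L"
    using finite_index_multiple_mem[OF assms] by blast
  then obtain d where d: "\<And>j. d j > 0 \<and> d j *s axis j 1 \<in> L"
    by metis
  define N where "N = (\<Prod>j\<in>UNIV. d j)"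
  have axis_mem: "N *s axis j 1 \<in> L" for j
  proof -
    obtain q where "N = q * d j"
      unfolding N_def by (metis dvd_prodI finite UNIV_I dvd_def mult.commute)
    then have "N *s axis j 1 = q *s (d j *s axis j 1)" by (simp add: vector_smult_assoc)
    then show ?thesis using subgroup_smult_mem[OF assms(1)] d by presburger
  qed
  have "v \<in> L" if "\<forall>i. N dvd v $ i" for v
  proof -
    have "(v $ j div N) *s (N *s axis j 1) = v $ j *s axis j 1" for j
      using that by (simp add: vector_smult_assoc)
    then have "v = (\<Sum>j\<in>UNIV. (v $ j div N) *s (N *s axis j 1))"
      by (simp add: basis_expansion)
    also have "\<dots> \<in> L"
      by (intro subgroup_sum[OF assms(1)] subgroup_smult_mem[OF assms(1)] axis_mem)
    finally show ?thesis .
  qed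
  moreover have "N > 0" unfolding N_def using d by (simp add: prod_pos)
  ultimately show ?thesis by blast
qed

section \<open>Walks and l1-norms\<close>

definition norm1 :: "int ^ 'n \<Rightarrow> int" where
  "norm1 v = (\<Sum>i\<in>UNIV. \<bar>v $ i\<bar>)"

lemma norm1_nonneg: "0 \<le> norm1 v"
  unfolding norm1_def by (simp add: sum_nonneg)

lemma norm1_eq_0_iff: "norm1 v = 0 \<longleftrightarrow> v = 0"
  unfolding norm1_def by (simp add: sum_nonneg_eq_0_iff vec_eq_iff)

lemma norm1_zero [simp]: "norm1 0 = 0"
  by (simp add: norm1_eq_0_iff)

lemma norm1_of_nonneg: "\<forall>i. 0 \<le> v $ i \<Longrightarrow> norm1 v = (\<Sum>i\<in>UNIV. v $ i)"
  unfolding norm1_def by simp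

lemma coset_has_bounded_nonneg_representative:
  assumes "is_subgroup L" "finite_index (L :: (int ^ 'n) set)"
  shows "\<exists>K. \<forall>w. \<exists>v. (\<forall>i. 0 \<le> v $ i) \<and> norm1 v \<le> K \<and> w + v \<in> L"
proof -
  obtain N where N: "N > 0" "\<And>v. \<forall>i. N dvd v $ i \<Longrightarrow> v \<in> L"
    using finite_index_contains_multiples[OF assms] by blast
  have "\<exists>v. (\<forall>i. 0 \<le> v $ i) \<and> norm1 v \<le> int CARD('n) * N \<and> w + v \<in> L" for w
  proof (intro exI conjI)
    let ?v = "\<chi> i. (- (w $ i)) mod N"
    show "\<forall>i. 0 \<le> ?v $ i" using N(1) by simp
    show "norm1 ?v \<le> int CARD('n) * N"
      unfolding norm1_def using N(1) sum_bounded_above[of UNIV "\<lambda>i. \<bar>?v $ i\<bar>" N]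
      by (simp add: less_imp_le)
    show "w + ?v \<in> L"
      by (intro N(2)) (simp add: mod_add_right_eq dvd_eq_mod_eq_0)
  qed
  then show ?thesis by blast
qed

lemma ustep_nth: "ustep s $ i = (if i = fst s then (if snd s then 1 else -1) else 0)"
  by (simp add: ustep_def axis_def)

lemma dstep_nth: "dstep j $ i = (if i = j then 1 else 0)"
  by (simp add: dstep_def axis_def)

lemma ustep_walk_exists: "\<exists>ss. length ss = nat (norm1 v) \<and> sum_list (map ustep ss) = v"
proof (induction "nat (norm1 v)" arbitrary: v)
  case 0
  then show ?case using norm1_nonneg[of v] by (simp add: norm1_eq_0_iff)
next
  case (Suc n)
  then obtain j where j: "v $ j \<noteq> 0"
    by (metis nat_0 norm1_eq_0_iff vec_eq_iff zero_index Zero_not_Suc)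
  define s where "s = (j, v $ j > 0)"
  have "\<bar>(v - ustep s) $ i\<bar> = \<bar>v $ i\<bar> - (if i = j then 1 else 0)" for i
    using j by (auto simp: ustep_nth s_def)
  then have "norm1 (v - ustep s) = norm1 v - 1"
    unfolding norm1_def by (simp add: sum_subtractf)
  then have "n = nat (norm1 (v - ustep s))" using Suc.hyps(2) by simp
  then obtain ss where "length ss = n" "sum_list (map ustep ss) = v - ustep s"
    using Suc.hyps(1) by metis
  then show ?case using Suc.hyps(2) by (intro exI[of _ "s # ss"]) simp
qed

lemma norm1_sum_ustep_le: "norm1 (sum_list (map ustep ss) :: int ^ 'n) \<le> int (length ss)"
proof (induction ss)
  case Nil
  then show ?case by (simp add: norm1_def)
next
  case (Cons s ss)
  have "norm1 (ustep s :: int ^ 'n) = 1"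
    unfolding norm1_def by (simp add: ustep_nth if_distrib[of abs] cong: if_cong)
  moreover have "norm1 (a + b) \<le> norm1 a + norm1 b" for a b :: "int ^ 'n"
    unfolding norm1_def sum.distrib[symmetric] by (intro sum_mono) (simp add: abs_triangle_ineq)
  ultimately have "norm1 (ustep s + sum_list (map ustep ss)) \<le> 1 + norm1 (sum_list (map ustep ss))"
    by metis
  then show ?case using Cons by simp
qed

lemma dstep_walk_exists:
  assumes "\<forall>i. 0 \<le> v $ i"
  shows "\<exists>js. length js = nat (norm1 v) \<and> sum_list (map dstep js) = v"
  using assms
proof (induction "nat (norm1 v)" arbitrary: v)
  case 0
  then show ?case using norm1_nonneg[of v] by (simp add: norm1_eq_0_iff)
next
  case (Suc n)
  then obtain j where j: "v $ j > 0"
    by (metis nat_0 norm1_eq_0_iff vec_eq_iff zero_index Zero_not_Suc order_le_less)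
  have comp: "(v - dstep j) $ i = v $ i - (if i = j then 1 else 0)" for i
    by (simp add: dstep_nth)
  then have "norm1 (v - dstep j) = norm1 v - 1"
    unfolding norm1_def using Suc.prems j by (simp add: sum_subtractf)
  moreover have "\<forall>i. 0 \<le> (v - dstep j) $ i"
    using Suc.prems j by (auto simp: comp dstep_nth)
  moreover have "n = nat (norm1 (v - dstep j))"
    using calculation(1) Suc.hyps(2) by simp
  ultimately obtain js where "length js = n" "sum_list (map dstep js) = v - dstep j"
    using Suc.hyps(1) by metis
  then show ?case using Suc.hyps(2) by (intro exI[of _ "j # js"]) simp
qed

lemma sum_dstep_nonneg_norm1:
  "(\<forall>i. 0 \<le> (sum_list (map dstep js) :: int ^ 'n) $ i) \<and>
   norm1 (sum_list (map dstep js) :: int ^ 'n) = int (length js)"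
proof (induction js)
  case Nil
  then show ?case by (simp add: norm1_def)
next
  case (Cons j js)
  let ?s = "sum_list (map dstep js) :: int ^ 'n"
  have nonneg: "\<forall>i. 0 \<le> ?s $ i"
    using Cons.IH by blast
  moreover have "(\<Sum>i\<in>UNIV. ?s $ i) = int (length js)"
    using Cons.IH norm1_of_nonneg[OF nonneg] by simp
  moreover have "(\<Sum>i\<in>UNIV. dstep j $ i) = (1::int)"
    by (simp add: dstep_nth)
  ultimately show ?case
    by (simp add: norm1_of_nonneg dstep_nth sum.distrib)
qed

section \<open>Graph distances as constrained norms of coset representatives\<close>

lemma emb_nth [simp]: "emb v $ i = real_of_int (v $ i)"
  by (simp add: emb_def)

lemma emb_zero [simp]: "emb 0 = 0"
  by (simp add: emb_def vec_eq_iff)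

lemma of_int_norm1: "real_of_int (norm1 v) = (\<Sum>i\<in>UNIV. \<bar>emb v $ i\<bar>)"
  by (simp add: norm1_def emb_def)

lemma emb_diff: "emb (a - b) = emb a - emb b"
  by (simp add: emb_def vec_eq_iff)

definition orthant :: "(real ^ 'n) set" where
  "orthant = {v. \<forall>i. 0 \<le> v $ i}"

lemma emb_in_orthant_iff [simp]: "emb v \<in> orthant \<longleftrightarrow> (\<forall>i. 0 \<le> v $ i)"
  by (simp add: orthant_def emb_def)

definition cone_dist :: "(real ^ 'n) set \<Rightarrow> (int ^ 'n) set \<Rightarrow> int ^ 'n \<Rightarrow> int ^ 'n \<Rightarrow> nat" where
  "cone_dist C L x y = (LEAST k. \<exists>v. emb v \<in> C \<and> norm1 v \<le> int k \<and> x + v - y \<in> L)"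

definition cone_diam :: "(real ^ 'n) set \<Rightarrow> (int ^ 'n) set \<Rightarrow> nat" where
  "cone_diam C L = Max {cone_dist C L x y | x y. True}"

lemma cone_dist_le: "emb v \<in> C \<Longrightarrow> x + v - y \<in> L \<Longrightarrow> cone_dist C L x y \<le> nat (norm1 v)"
  unfolding cone_dist_def by (rule Least_le) auto

lemma cone_dist_witness:
  assumes "emb u \<in> C" "x + u - y \<in> L"
  shows "\<exists>v. emb v \<in> C \<and> norm1 v \<le> int (cone_dist C L x y) \<and> x + v - y \<in> L"
proof -
  have "\<exists>v. emb v \<in> C \<and> norm1 v \<le> int (nat (norm1 u)) \<and> x + v - y \<in> L"
    using assms by auto
  then show ?thesis
    unfolding cone_dist_def by (rule LeastI)
qed

lemma cone_dist_orthant_witness: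
  assumes "is_subgroup L" "finite_index L" "orthant \<subseteq> C"
  shows "\<exists>v. emb v \<in> C \<and> norm1 v \<le> int (cone_dist C L x y) \<and> x + v - y \<in> L"
proof -
  obtain u where "\<forall>i. 0 \<le> u $ i" "(x - y) + u \<in> L"
    using coset_has_bounded_nonneg_representative[OF assms(1,2)] by blast
  then show ?thesis
    using assms(3) by (intro cone_dist_witness[of u]) (auto simp: algebra_simps)
qed

lemma udist_eq_cone_dist:
  assumes "is_subgroup L"
  shows "udist L x y = cone_dist UNIV L x y"
proof (rule antisym)
  have "x + (y - x) - y \<in> L" using assms by (simp add: is_subgroup_def)
  then obtain v where v: "norm1 v \<le> int (cone_dist UNIV L x y)" "x + v - y \<in> L"
    using cone_dist_witness[of "y - x" UNIV x y L] by auto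
  obtain ss where "length ss = nat (norm1 v)" "sum_list (map ustep ss) = v"
    using ustep_walk_exists by blast
  then have "udist L x y \<le> nat (norm1 v)"
    unfolding udist_def using v(2) by (intro Least_le) auto
  then show "udist L x y \<le> cone_dist UNIV L x y" using v(1) by linarith
next
  obtain ss0 where "sum_list (map ustep ss0) = y - x"
    using ustep_walk_exists by blast
  then have "x + sum_list (map ustep ss0) - y \<in> L"
    using assms by (simp add: is_subgroup_def)
  then have "\<exists>k ss. length ss = k \<and> x + sum_list (map ustep ss) - y \<in> L"
    by blast
  then have "\<exists>ss. length ss = udist L x y \<and> x + sum_list (map ustep ss) - y \<in> L"
    unfolding udist_def by (rule LeastI_ex)
  then obtain ss where ss: "length ss = udist L x y" "x + sum_list (map ustep ss) - y \<in> L"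
    by blast
  show "cone_dist UNIV L x y \<le> udist L x y"
    using cone_dist_le[of "sum_list (map ustep ss)" UNIV x y L] ss norm1_sum_ustep_le[of ss] by simp
qed

lemma ddist_eq_cone_dist:
  assumes "is_subgroup L" "finite_index L"
  shows "ddist L x y = cone_dist orthant L x y"
proof (rule antisym)
  obtain v where v: "\<forall>i. 0 \<le> v $ i" "norm1 v \<le> int (cone_dist orthant L x y)" "x + v - y \<in> L"
    using cone_dist_orthant_witness[OF assms order_refl, of x y] by auto
  obtain js where js: "length js = nat (norm1 v)" "sum_list (map dstep js) = v"
    using dstep_walk_exists[OF v(1)] by blast
  then have "ddist L x y \<le> nat (norm1 v)"
    unfolding ddist_def using v(3) by (intro Least_le) auto
  then show "ddist L x y \<le> cone_dist orthant L x y" using v(2) by linarith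
  have "\<exists>k js. length js = k \<and> x + sum_list (map dstep js) - y \<in> L"
    using js v(3) by blast
  then have "\<exists>js. length js = ddist L x y \<and> x + sum_list (map dstep js) - y \<in> L"
    unfolding ddist_def by (rule LeastI_ex)
  then obtain js' where js': "length js' = ddist L x y" "x + sum_list (map dstep js') - y \<in> L"
    by blast
  show "cone_dist orthant L x y \<le> ddist L x y"
    using cone_dist_le[of "sum_list (map dstep js')" orthant x y L] js' sum_dstep_nonneg_norm1[of js']
    by simp
qed

lemma cone_dist_bounded:
  assumes "is_subgroup L" "finite_index L" "orthant \<subseteq> C"
  shows "\<exists>K. \<forall>x y. cone_dist C L x y \<le> K"
proof -
  obtain K where K: "\<And>w. \<exists>v. (\<forall>i. 0 \<le> v $ i) \<and> norm1 v \<le> K \<and> w + v \<in> L"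
    using coset_has_bounded_nonneg_representative[OF assms(1,2)] by blast
  have "cone_dist C L x y \<le> nat K" for x y
  proof -
    obtain v where v: "\<forall>i. 0 \<le> v $ i" "norm1 v \<le> K" "(x - y) + v \<in> L"
      using K by blast
    then have "cone_dist C L x y \<le> nat (norm1 v)"
      using assms(3) by (intro cone_dist_le) (auto simp: algebra_simps)
    then show ?thesis using v(2) by linarith
  qed
  then show ?thesis by blast
qed

lemma finite_cone_dist_values:
  assumes "is_subgroup L" "finite_index L" "orthant \<subseteq> C"
  shows "finite {cone_dist C L x y | x y. True}"
proof -
  obtain K where "\<And>x y. cone_dist C L x y \<le> K"
    using cone_dist_bounded[OF assms] by blast
  then have "{cone_dist C L x y | x y. True} \<subseteq> {..K}" by auto
  then show ?thesis using finite_subset by blast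
qed

lemma cone_dist_le_cone_diam:
  assumes "is_subgroup L" "finite_index L" "orthant \<subseteq> C"
  shows "cone_dist C L x y \<le> cone_diam C L"
  unfolding cone_diam_def using finite_cone_dist_values[OF assms] by (rule Max_ge) blast

lemma cone_diam_attained:
  assumes "is_subgroup L" "finite_index L" "orthant \<subseteq> C"
  obtains x y where "cone_diam C L = cone_dist C L x y"
proof -
  have "cone_diam C L \<in> {cone_dist C L x y | x y. True}"
    unfolding cone_diam_def using finite_cone_dist_values[OF assms] by (rule Max_in) blast
  then show ?thesis using that by blast
qed

lemma udiam_eq_cone_diam: "is_subgroup L \<Longrightarrow> udiam L = cone_diam UNIV L"
  by (simp add: udiam_def cone_diam_def udist_eq_cone_dist)

lemma ddiam_eq_cone_diam: "is_subgroup L \<Longrightarrow> finite_index L \<Longrightarrow> ddiam L = cone_diam orthant L"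
  by (simp add: ddiam_def cone_diam_def ddist_eq_cone_dist)

section \<open>Diameter and covering radius\<close>

definition cover_radii :: "(real ^ 'n) set \<Rightarrow> (real ^ 'n) set \<Rightarrow> real set" where
  "cover_radii B R = {t. t > 0 \<and> {l + t *\<^sub>R b | l b. l \<in> R \<and> b \<in> B} = UNIV}"

lemma cov_radius_eq_Inf: "cov_radius B R = Inf (cover_radii B R)"
  by (simp add: cov_radius_def cover_radii_def)

lemma mem_cover_radii: "t \<in> cover_radii B R \<longleftrightarrow> t > 0 \<and> (\<forall>p. \<exists>l\<in>R. \<exists>b\<in>B. p = l + t *\<^sub>R b)"
  unfolding cover_radii_def by blast

lemma cover_radii_scaleR:
  assumes "c > 0"
  shows "t \<in> cover_radii B ((*\<^sub>R) c ` R) \<longleftrightarrow> t / c \<in> cover_radii B R"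
proof -
  have shift: "(\<exists>l\<in>(*\<^sub>R) c ` R. \<exists>b\<in>B. p = l + t *\<^sub>R b) \<longleftrightarrow>
        (\<exists>l\<in>R. \<exists>b\<in>B. p /\<^sub>R c = l + (t / c) *\<^sub>R b)" for p
  proof -
    have "p = c *\<^sub>R l + t *\<^sub>R b \<longleftrightarrow> p /\<^sub>R c = l + (t / c) *\<^sub>R b" for l b
    proof -
      have "l + (t / c) *\<^sub>R b = (c *\<^sub>R l + t *\<^sub>R b) /\<^sub>R c"
        using assms by (simp add: scaleR_add_right divide_inverse_commute)
      then show ?thesis using assms by simp
    qed
    then show ?thesis by blast
  qed
  have substitute: "(\<forall>p. P (p /\<^sub>R c)) \<longleftrightarrow> (\<forall>q. P q)" for P :: "real ^ 'n \<Rightarrow> bool"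
  proof
    assume "\<forall>p. P (p /\<^sub>R c)"
    then have "P ((c *\<^sub>R q) /\<^sub>R c)" for q by blast
    then show "\<forall>q. P q" using assms by simp
  qed simp
  show ?thesis
    unfolding mem_cover_radii shift
    using substitute[of "\<lambda>q. \<exists>l\<in>R. \<exists>b\<in>B. q = l + (t / c) *\<^sub>R b"] assms
    by (simp add: zero_less_divide_iff)
qed

definition cone_body :: "(real ^ 'n) set \<Rightarrow> (real ^ 'n) set" where
  "cone_body C = {b \<in> C. (\<Sum>i\<in>UNIV. \<bar>b $ i\<bar>) < 1}"

lemma Bu_eq_cone_body: "Bu = cone_body UNIV"
  by (simp add: Bu_def cone_body_def)

lemma Bd_eq_cone_body: "Bd = cone_body orthant"
  by (auto simp: Bd_def cone_body_def orthant_def)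

lemma rlat_near_every_point:
  fixes C :: "(real ^ 'n) set"
  assumes "convex C" "cone C" "orthant \<subseteq> C" "is_subgroup L" "finite_index L"
  shows "\<exists>l\<in>L. p - emb l \<in> C \<and>
           (\<Sum>i\<in>UNIV. \<bar>(p - emb l) $ i\<bar>) < real (cone_diam C L) + real CARD('n)"
proof -
  define z :: "int ^ 'n" where "z = (\<chi> i. \<lfloor>p $ i\<rfloor>)"
  define f where "f = p - emb z"
  have f: "0 \<le> f $ i" "f $ i < 1" for i
    by (simp_all add: f_def z_def emb_def) linarith
  obtain v where v: "emb v \<in> C" "norm1 v \<le> int (cone_dist C L 0 z)" "0 + v - z \<in> L"
    using cone_dist_orthant_witness[OF assms(4,5,3)] by blast
  have "cone_dist C L 0 z \<le> cone_diam C L"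
    by (rule cone_dist_le_cone_diam[OF assms(4,5,3)])
  then have v_small: "real_of_int (norm1 v) \<le> real (cone_diam C L)"
    using v(2) by linarith
  have p_minus: "p - emb (z - v) = f + emb v"
    by (simp add: f_def emb_diff)
  have "f \<in> C" using f assms(3) by (auto simp: orthant_def less_imp_le)
  then have "f + emb v \<in> C"
    using v(1) assms(1,2) convex_cone by blast
  moreover have "(\<Sum>i\<in>UNIV. \<bar>(f + emb v) $ i\<bar>) \<le> (\<Sum>i\<in>UNIV. f $ i) + (\<Sum>i\<in>UNIV. \<bar>emb v $ i\<bar>)"
    unfolding sum.distrib[symmetric] using f
    by (intro sum_mono) (simp add: abs_triangle_ineq order_trans[OF abs_triangle_ineq])
  moreover have "(\<Sum>i\<in>UNIV. f $ i) < (\<Sum>i\<in>(UNIV :: 'n set). 1)"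
    by (rule sum_strict_mono) (simp_all add: f)
  ultimately have "f + emb v \<in> C \<and>
      (\<Sum>i\<in>UNIV. \<bar>(f + emb v) $ i\<bar>) < real (cone_diam C L) + real CARD('n)"
    using v_small unfolding of_int_norm1 by simp
  moreover have "z - v \<in> L"
    using v(3) subgroup_diff_swap[OF assms(4)] by simp
  ultimately show ?thesis
    unfolding p_minus[symmetric] by blast
qed

lemma rlat_cover_by_cone_body:
  fixes C :: "(real ^ 'n) set"
  assumes "convex C" "cone C" "orthant \<subseteq> C" "is_subgroup L" "finite_index L"
  shows "real (cone_diam C L) + real CARD('n) \<in> cover_radii (cone_body C) (rlat L)"
proof -
  define s where "s = real (cone_diam C L) + real CARD('n)"
  have "CARD('n) > 0" by (simp add: card_gt_0_iff)
  then have s_pos: "s > 0" unfolding s_def by linarith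
  have "\<exists>l\<in>rlat L. \<exists>b\<in>cone_body C. p = l + s *\<^sub>R b" for p
  proof -
    obtain l where l: "l \<in> L" "p - emb l \<in> C" "(\<Sum>i\<in>UNIV. \<bar>(p - emb l) $ i\<bar>) < s"
      using rlat_near_every_point[OF assms] unfolding s_def by blast
    define r where "r = p - emb l"
    have "r /\<^sub>R s \<in> C"
      using l(2) s_pos by (simp add: r_def mem_cone[OF assms(2)])
    moreover have "(\<Sum>i\<in>UNIV. \<bar>(r /\<^sub>R s) $ i\<bar>) = (\<Sum>i\<in>UNIV. \<bar>r $ i\<bar>) / s"
      using s_pos by (simp add: sum_distrib_left abs_mult divide_inverse_commute)
    ultimately have "r /\<^sub>R s \<in> cone_body C"
      using l(3) s_pos by (simp add: cone_body_def r_def)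
    moreover have "p = emb l + s *\<^sub>R (r /\<^sub>R s)"
      using s_pos by (simp add: r_def)
    ultimately show ?thesis
      using l(1) unfolding rlat_def by blast
  qed
  then show ?thesis using s_pos unfolding s_def mem_cover_radii by blast
qed

lemma cone_diam_less_cover_radius:
  assumes "cone C" "orthant \<subseteq> C" "is_subgroup L" "finite_index L"
    and t: "t \<in> cover_radii (cone_body C) (rlat L)"
  shows "real (cone_diam C L) < t"
proof -
  obtain x y where xy: "cone_diam C L = cone_dist C L x y"
    using cone_diam_attained[OF assms(3,4,2)] by blast
  obtain l b where lb: "l \<in> L" "b \<in> cone_body C" "emb (y - x) = emb l + t *\<^sub>R b"
    using t unfolding mem_cover_radii rlat_def by blast
  define w where "w = y - x - l"
  have emb_w: "emb w = t *\<^sub>R b"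
    using lb(3) by (simp add: w_def emb_diff)
  have "t > 0" using t by (simp add: mem_cover_radii)
  then have "emb w \<in> C"
    using lb(2) unfolding emb_w cone_body_def by (auto intro: mem_cone[OF assms(1)])
  moreover have "x + w - y \<in> L"
    using lb(1) assms(3) by (simp add: w_def is_subgroup_def)
  ultimately have "cone_dist C L x y \<le> nat (norm1 w)"
    by (rule cone_dist_le)
  moreover have "real_of_int (norm1 w) < t"
  proof -
    have "real_of_int (norm1 w) = t * (\<Sum>i\<in>UNIV. \<bar>b $ i\<bar>)"
      using \<open>t > 0\<close> by (simp add: of_int_norm1 emb_w abs_mult sum_distrib_left)
    also have "\<dots> < t"
      using lb(2) \<open>t > 0\<close> by (simp add: cone_body_def)
    finally show ?thesis .
  qed
  ultimately show ?thesis using xy norm1_nonneg[of w] by linarith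
qed

lemma cone_orthant: "cone orthant"
  by (simp add: cone_def orthant_def)

lemma convex_orthant: "convex orthant"
  unfolding convex_def orthant_def by simp

lemma cov_radius_scaled_rlat:
  fixes C :: "(real ^ 'n) set"
  assumes "convex C" "cone C" "orthant \<subseteq> C" "is_subgroup L" "finite_index L" "c > 0"
  shows "\<bar>c * real (cone_diam C L) - cov_radius (cone_body C) ((*\<^sub>R) c ` rlat L)\<bar>
           \<le> c * real CARD('n)"
proof -
  let ?T = "cover_radii (cone_body C) ((*\<^sub>R) c ` rlat L)"
  let ?D = "real (cone_diam C L)"
  have top: "c * (?D + real CARD('n)) \<in> ?T"
    using rlat_cover_by_cone_body[OF assms(1-5)] assms(6) by (simp add: cover_radii_scaleR)
  have below: "c * ?D < t" if "t \<in> ?T" for t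
  proof -
    have "?D < t / c"
      using cone_diam_less_cover_radius[OF assms(2-5)] that assms(6) by (simp add: cover_radii_scaleR)
    then show ?thesis using assms(6) by (simp add: pos_less_divide_eq mult.commute)
  qed
  have "c * ?D \<le> Inf ?T"
    using top below by (intro cInf_greatest) (auto intro: less_imp_le)
  moreover have "Inf ?T \<le> c * (?D + real CARD('n))"
    using top below by (intro cInf_lower) (auto simp: bdd_below_def intro: less_imp_le)
  ultimately show ?thesis
    by (simp add: cov_radius_eq_Inf abs_le_iff algebra_simps)
qed

section \<open>Girth and first minimum\<close>

definition closed_walk_length :: "(int ^ 'n) set \<Rightarrow> nat \<Rightarrow> bool" where
  "closed_walk_length L k \<longleftrightarrow> k \<ge> 1 \<and> (\<exists>js. length js = k \<and> sum_list (map dstep js) \<in> L)"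

lemma sum_list_map_take_add_drop:
  "i \<le> i' \<Longrightarrow> sum_list (map f (take i' js)) = sum_list (map f (take i js)) + sum_list (map f (drop i (take i' js)))"
proof -
  assume "i \<le> i'"
  then have "take i' js = take i js @ drop i (take i' js)"
    by (metis append_take_drop_id min.absorb1 take_take)
  then show ?thesis by (metis map_append sum_list_append)
qed

lemma shortest_closed_walk_vertices_distinct:
  fixes L :: "(int ^ 'n) set"
  assumes "is_subgroup L" "length js = (LEAST k. closed_walk_length L k)"
    and "i < length js" "i' < length js" "i \<noteq> i'"
  shows "sum_list (map dstep (take i js)) - sum_list (map dstep (take i' js)) \<notin> L"
proof -
  let ?S = "\<lambda>i. sum_list (map dstep (take i js)) :: int ^ 'n"
  \<comment> \<open>a repeated vertex would split off a strictly shorter closed walk\<close>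
  have distinct: "?S b - ?S a \<notin> L" if "a < b" "b < length js" for a b
  proof
    assume "?S b - ?S a \<in> L"
    moreover have "?S b - ?S a = sum_list (map dstep (drop a (take b js)))"
      using sum_list_map_take_add_drop[of a b dstep js] that by simp
    moreover have "length (drop a (take b js)) = b - a"
      using that by simp
    ultimately have "closed_walk_length L (b - a)"
      unfolding closed_walk_length_def using that
      by (intro conjI exI[of _ "drop a (take b js)"]) auto
    then have "length js \<le> b - a"
      unfolding assms(2) by (rule Least_le)
    then show False using that by simp
  qed
  show ?thesis
  proof (cases "i < i'")
    case True
    then show ?thesis using distinct[of i i'] subgroup_diff_swap[OF assms(1)] assms(4) by blast
  next
    case False
    then show ?thesis using distinct[of i' i] assms(3,5) by simp
  qed
qed

lemma dgirth_eq_shortest_closed_walk: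
  fixes L :: "(int ^ 'n) set"
  assumes "is_subgroup L" "\<exists>k. closed_walk_length L k"
  shows "dgirth L = (LEAST k. closed_walk_length L k)"
  unfolding dgirth_def
proof (rule Least_equality)
  have "closed_walk_length L (LEAST k. closed_walk_length L k)"
    using assms(2) by (rule LeastI_ex)
  then obtain js where js: "length js = (LEAST k. closed_walk_length L k)"
    "sum_list (map dstep js) \<in> L" "length js \<ge> 1"
    unfolding closed_walk_length_def by auto
  then show "(LEAST k. closed_walk_length L k) \<ge> 1 \<and>
      (\<exists>js. length js = (LEAST k. closed_walk_length L k) \<and> sum_list (map dstep js) \<in> L \<and>
        (\<forall>i<(LEAST k. closed_walk_length L k). \<forall>i'<(LEAST k. closed_walk_length L k). i \<noteq> i' \<longrightarrow>
          sum_list (map dstep (take i js)) - sum_list (map dstep (take i' js)) \<notin> L))"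
    using shortest_closed_walk_vertices_distinct[OF assms(1) js(1)] by auto
next
  fix k
  assume "k \<ge> 1 \<and> (\<exists>js. length js = k \<and> sum_list (map dstep js) \<in> L \<and>
      (\<forall>i<k. \<forall>i'<k. i \<noteq> i' \<longrightarrow>
          sum_list (map dstep (take i js)) - sum_list (map dstep (take i' js)) \<notin> L))"
  then have "closed_walk_length L k"
    unfolding closed_walk_length_def by blast
  then show "(LEAST k. closed_walk_length L k) \<le> k"
    by (rule Least_le)
qed

lemma closed_walk_length_iff:
  "closed_walk_length L k \<longleftrightarrow> (\<exists>v\<in>L. (\<forall>i. 0 \<le> v $ i) \<and> v \<noteq> 0 \<and> norm1 v = int k)"
proof
  assume "closed_walk_length L k"
  then obtain js where "length js = k" "k \<ge> 1" "sum_list (map dstep js) \<in> L"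
    unfolding closed_walk_length_def by blast
  then show "\<exists>v\<in>L. (\<forall>i. 0 \<le> v $ i) \<and> v \<noteq> 0 \<and> norm1 v = int k"
    using sum_dstep_nonneg_norm1[of js]
    by (intro bexI[of _ "sum_list (map dstep js)"]) auto
next
  assume "\<exists>v\<in>L. (\<forall>i. 0 \<le> v $ i) \<and> v \<noteq> 0 \<and> norm1 v = int k"
  then obtain v where v: "v \<in> L" "\<forall>i. 0 \<le> v $ i" "v \<noteq> 0" "norm1 v = int k"
    by blast
  then obtain js where "length js = k" "sum_list (map dstep js) = v"
    using dstep_walk_exists[OF v(2)] by auto
  moreover have "k \<ge> 1"
    using v(3,4) norm1_eq_0_iff[of v] by simp
  ultimately show "closed_walk_length L k"
    unfolding closed_walk_length_def using v(1) by blast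
qed

lemma finite_index_nonneg_nonzero_mem:
  assumes "is_subgroup L" "finite_index (L :: (int ^ 'n) set)"
  shows "\<exists>v\<in>L. (\<forall>i. 0 \<le> v $ i) \<and> v \<noteq> 0"
proof -
  obtain N where N: "N > 0" "\<And>v. \<forall>i. N dvd v $ i \<Longrightarrow> v \<in> L"
    using finite_index_contains_multiples[OF assms] by blast
  then show ?thesis
    by (intro bexI[of _ "\<chi> i. N"]) (auto simp: vec_eq_iff)
qed

lemma dgirth_eq_least_norm1:
  assumes "is_subgroup L" "finite_index L"
  shows "dgirth L = (LEAST k. \<exists>v\<in>L. (\<forall>i. 0 \<le> v $ i) \<and> v \<noteq> 0 \<and> norm1 v = int k)"
proof -
  obtain v where "v \<in> L" "\<forall>i. 0 \<le> v $ i" "v \<noteq> 0"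
    using finite_index_nonneg_nonzero_mem[OF assms] by blast
  then have "closed_walk_length L (nat (norm1 v))"
    unfolding closed_walk_length_iff using norm1_nonneg[of v] by (intro bexI[of _ v]) auto
  then have "dgirth L = (LEAST k. closed_walk_length L k)"
    using dgirth_eq_shortest_closed_walk[OF assms(1)] by blast
  then show ?thesis
    by (simp add: closed_walk_length_iff)
qed

lemma dgirth_attained:
  assumes "is_subgroup L" "finite_index L"
  obtains v where "v \<in> L" "\<forall>i. 0 \<le> v $ i" "v \<noteq> 0" "norm1 v = int (dgirth L)"
proof -
  obtain v where "v \<in> L" "\<forall>i. 0 \<le> v $ i" "v \<noteq> 0"
    using finite_index_nonneg_nonzero_mem[OF assms] by blast
  then have "\<exists>k. \<exists>v\<in>L. (\<forall>i. 0 \<le> v $ i) \<and> v \<noteq> 0 \<and> norm1 v = int k"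
    using norm1_nonneg[of v] by (intro exI[of _ "nat (norm1 v)"]) auto
  then have "\<exists>v\<in>L. (\<forall>i. 0 \<le> v $ i) \<and> v \<noteq> 0 \<and> norm1 v = int (dgirth L)"
    unfolding dgirth_eq_least_norm1[OF assms] by (rule LeastI_ex)
  then show ?thesis using that by blast
qed

lemma dgirth_le_norm1:
  assumes "is_subgroup L" "finite_index L" "w \<in> L" "\<forall>i. 0 \<le> w $ i" "w \<noteq> 0"
  shows "int (dgirth L) \<le> norm1 w"
proof -
  have "dgirth L \<le> nat (norm1 w)"
    unfolding dgirth_eq_least_norm1[OF assms(1,2)]
    using assms(3-5) norm1_nonneg[of w] by (intro Least_le) auto
  then show ?thesis using norm1_nonneg[of w] by linarith
qed

definition min_radii :: "(real ^ 'n) set \<Rightarrow> (real ^ 'n) set \<Rightarrow> real set" where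
  "min_radii B R = {t. t > 0 \<and> ((\<lambda>b. t *\<^sub>R b) ` B) \<inter> R \<noteq> {0}}"

lemma min_radius_eq_Inf: "min_radius B R = Inf (min_radii B R)"
  by (simp add: min_radius_def min_radii_def)

lemma min_radii_scaleR:
  fixes B R :: "(real ^ 'n) set"
  assumes "c > 0"
  shows "t \<in> min_radii B ((*\<^sub>R) c ` R) \<longleftrightarrow> t / c \<in> min_radii B R"
proof -
  have inj: "inj ((*\<^sub>R) c :: real ^ 'n \<Rightarrow> real ^ 'n)"
    using assms by (simp add: inj_on_def)
  have "(\<lambda>b. t *\<^sub>R b) ` B \<inter> (*\<^sub>R) c ` R = (*\<^sub>R) c ` ((\<lambda>b. (t / c) *\<^sub>R b) ` B \<inter> R)"
    using assms by (simp add: image_Int[OF inj] image_image)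
  moreover have "(*\<^sub>R) c ` X = {0} \<longleftrightarrow> X = {0}" for X :: "(real ^ 'n) set"
    using inj_image_eq_iff[OF inj, of X "{0}"] by simp
  ultimately show ?thesis
    using assms by (simp add: min_radii_def zero_less_divide_iff)
qed

lemma dgirth_less_min_radii:
  assumes "is_subgroup L" "finite_index L" "t \<in> min_radii Bd (rlat L)"
  shows "real (dgirth L) < t"
proof -
  have t_pos: "t > 0" and ne: "(*\<^sub>R) t ` Bd \<inter> rlat L \<noteq> {0}"
    using assms(3) unfolding min_radii_def by auto
  have "t *\<^sub>R 0 \<in> (*\<^sub>R) t ` Bd"
    by (intro imageI) (simp add: Bd_def)
  moreover have "emb 0 \<in> rlat L"
    using assms(1) unfolding rlat_def is_subgroup_def by blast
  ultimately have "0 \<in> (*\<^sub>R) t ` Bd \<inter> rlat L"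
    by simp
  then obtain y where "y \<in> (*\<^sub>R) t ` Bd" "y \<in> rlat L" "y \<noteq> 0"
    using ne by blast
  then obtain b w where bw: "b \<in> Bd" "w \<in> L" "t *\<^sub>R b = emb w" "emb w \<noteq> 0"
    unfolding rlat_def by auto
  have b: "\<forall>i. 0 \<le> b $ i" "(\<Sum>i\<in>UNIV. b $ i) < 1"
    using bw(1) by (auto simp: Bd_def)
  have w_comp: "real_of_int (w $ i) = t * b $ i" for i
    using arg_cong[OF bw(3), of "\<lambda>x. x $ i"] by simp
  have "\<forall>i. 0 \<le> w $ i"
    using w_comp b(1) t_pos by (metis of_int_0_le_iff mult_nonneg_nonneg less_imp_le)
  moreover have "w \<noteq> 0"
    using bw(4) by auto
  ultimately have "real (dgirth L) \<le> real_of_int (norm1 w)"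
    using dgirth_le_norm1[OF assms(1,2) bw(2)] by (metis of_int_le_iff of_int_of_nat_eq)
  also have "real_of_int (norm1 w) = t * (\<Sum>i\<in>UNIV. b $ i)"
    using b(1) t_pos by (simp add: of_int_norm1 w_comp sum_distrib_left)
  also have "\<dots> < t"
    using b(2) t_pos by simp
  finally show ?thesis .
qed

lemma dgirth_less_imp_min_radii:
  assumes "is_subgroup L" "finite_index L" "real (dgirth L) < t"
  shows "t \<in> min_radii Bd (rlat L)"
proof -
  have t_pos: "t > 0" using assms(3) by linarith
  obtain v where v: "v \<in> L" "\<forall>i. 0 \<le> v $ i" "v \<noteq> 0" "norm1 v = int (dgirth L)"
    using dgirth_attained[OF assms(1,2)] by blast
  have "emb v /\<^sub>R t \<in> Bd"
  proof -
    have "(\<Sum>i\<in>UNIV. (emb v /\<^sub>R t) $ i) = real (dgirth L) / t"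
      using v(2,4) of_int_norm1[of v] by (simp add: divide_inverse_commute sum_distrib_left)
    then show ?thesis using v(2) assms(3) t_pos by (simp add: Bd_def)
  qed
  moreover have "t *\<^sub>R (emb v /\<^sub>R t) = emb v" using t_pos by simp
  ultimately have "emb v \<in> (*\<^sub>R) t ` Bd \<inter> rlat L"
    unfolding rlat_def using v(1) by (metis IntI image_eqI)
  moreover have "emb v \<noteq> 0" using v(3) by (auto simp: emb_def vec_eq_iff)
  ultimately show ?thesis
    unfolding min_radii_def using t_pos by blast
qed

lemma min_radii_rlat:
  assumes "is_subgroup L" "finite_index L"
  shows "min_radii Bd (rlat L) = {real (dgirth L) <..}"
  using dgirth_less_min_radii[OF assms] dgirth_less_imp_min_radii[OF assms] by auto

lemma min_radius_scaled_rlat: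
  assumes "is_subgroup L" "finite_index L" "c > 0"
  shows "min_radius Bd ((*\<^sub>R) c ` rlat L) = c * real (dgirth L)"
proof -
  have "min_radii Bd ((*\<^sub>R) c ` rlat L) = {c * real (dgirth L) <..}"
    using assms by (auto simp: min_radii_scaleR min_radii_rlat[OF assms(1,2)] pos_less_divide_eq mult.commute)
  then show ?thesis by (simp add: min_radius_eq_Inf)
qed

section \<open>Normalisation\<close>

lemma covol_pos: "finite_index L \<Longrightarrow> covol L > 0"
  unfolding finite_index_def covol_def cosets_def
  by (metis card_gt_0_iff empty_iff quotientI UNIV_I)

lemma uniform_bound_from_scaled_bound:
  fixes \<xi> :: "(int ^ 'n) set \<Rightarrow> nat" and \<zeta> :: "(real ^ 'n) set \<Rightarrow> real"
  assumes "\<And>L c. is_subgroup L \<Longrightarrow> finite_index L \<Longrightarrow> c > 0 \<Longrightarrow>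
             \<bar>c * real (\<xi> L) - \<zeta> ((*\<^sub>R) c ` rlat L)\<bar> \<le> c * K"
  shows "\<exists>C::real. \<forall>L :: (int ^ 'n) set. is_subgroup L \<and> finite_index L \<longrightarrow>
           \<bar>real (\<xi> L) - \<zeta> (rlat L)\<bar> \<le> C \<and>
           \<bar>real (covol L) powr (- 1 / real CARD('n)) * real (\<xi> L) - \<zeta> (nlat L)\<bar>
             \<le> C * real (covol L) powr (- 1 / real CARD('n))"
proof (intro exI[of _ K] allI impI conjI)
  fix L :: "(int ^ 'n) set"
  assume L: "is_subgroup L \<and> finite_index L"
  show "\<bar>real (\<xi> L) - \<zeta> (rlat L)\<bar> \<le> K"
    using assms[of L 1] L by simp
  have "real (covol L) powr (- 1 / real CARD('n)) > 0"
    using covol_pos[of L] L by simp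
  then show "\<bar>real (covol L) powr (- 1 / real CARD('n)) * real (\<xi> L) - \<zeta> (nlat L)\<bar>
               \<le> K * real (covol L) powr (- 1 / real CARD('n))"
    using assms[of L "real (covol L) powr (- 1 / real CARD('n))"] L
    unfolding nlat_def by (simp only: mult.commute)
qed

theorem lemma3p3:
  assumes "CARD('n::finite) \<ge> 2"
  shows
   "(\<exists>C::real. \<forall>L :: (int ^ 'n) set. is_subgroup L \<and> finite_index L \<longrightarrow>
        \<bar>real (udiam L) - cov_radius Bu (rlat L)\<bar> \<le> C \<and>
        \<bar>real (covol L) powr (- 1 / real CARD('n)) * real (udiam L) - cov_radius Bu (nlat L)\<bar>
          \<le> C * real (covol L) powr (- 1 / real CARD('n)))
  \<and> (\<exists>C::real. \<forall>L :: (int ^ 'n) set. is_subgroup L \<and> finite_index L \<longrightarrow>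
        \<bar>real (ddiam L) - cov_radius Bd (rlat L)\<bar> \<le> C \<and>
        \<bar>real (covol L) powr (- 1 / real CARD('n)) * real (ddiam L) - cov_radius Bd (nlat L)\<bar>
          \<le> C * real (covol L) powr (- 1 / real CARD('n)))
  \<and> (\<exists>C::real. \<forall>L :: (int ^ 'n) set. is_subgroup L \<and> finite_index L \<longrightarrow>
        \<bar>real (dgirth L) - min_radius Bd (rlat L)\<bar> \<le> C \<and>
        \<bar>real (covol L) powr (- 1 / real CARD('n)) * real (dgirth L) - min_radius Bd (nlat L)\<bar>
          \<le> C * real (covol L) powr (- 1 / real CARD('n)))"
proof (intro conjI uniform_bound_from_scaled_bound)
  fix L :: "(int ^ 'n) set" and c :: real
  assume L: "is_subgroup L" "finite_index L" and c: "c > 0"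
  show "\<bar>c * real (udiam L) - cov_radius Bu ((*\<^sub>R) c ` rlat L)\<bar> \<le> c * real CARD('n)"
    using cov_radius_scaled_rlat[of UNIV, OF _ _ _ L c]
    by (simp add: udiam_eq_cone_diam[OF L(1)] Bu_eq_cone_body)
  show "\<bar>c * real (ddiam L) - cov_radius Bd ((*\<^sub>R) c ` rlat L)\<bar> \<le> c * real CARD('n)"
    using cov_radius_scaled_rlat[OF convex_orthant cone_orthant order_refl L c]
    by (simp add: ddiam_eq_cone_diam[OF L] Bd_eq_cone_body)
  show "\<bar>c * real (dgirth L) - min_radius Bd ((*\<^sub>R) c ` rlat L)\<bar> \<le> c * 0"
    by (simp add: min_radius_scaled_rlat[OF L c])
qed

end
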